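(* If $B\in\mathbb{R}^{n\times n}$ is a nonnegative bidiagonal matrix then its matrix exponential $\mathrm{e}^B$ is totally nonnegative.
   Context: A matrix is bidiagonal if it is upper bidiagonal (its only possibly nonzero entries are in positions $(i,i)$ and $(i,i+1)$) or lower bidiagonal (its transpose is upper bidiagonal). A matrix is nonnegative if all its entries are nonnegative. A matrix $A\in\mathbb{R}^{n\times n}$ is totally nonnegative if every minor (determinant of a square submatrix) is nonnegative. *)

theory Defs
  imports
    Complex_Main
    "Jordan_Normal_Form.Jordan_Normal_Form"
    "Jordan_Normal_Form.DL_Submatrix"
begin

definition upper_bidiagonal :: "'a::zero mat \<Rightarrow> bool" where
  "upper_bidiagonal A \<longleftrightarrow>
     (\<forall>i<dim_row A. \<forall>j<dim_col A. A $$ (i, j) \<noteq> 0 \<longrightarrow> j = i \<or> j = i + 1)"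

definition lower_bidiagonal :: "'a::zero mat \<Rightarrow> bool" where
  "lower_bidiagonal A \<longleftrightarrow> upper_bidiagonal (transpose_mat A)"

definition bidiagonal :: "'a::zero mat \<Rightarrow> bool" where
  "bidiagonal A \<longleftrightarrow> upper_bidiagonal A \<or> lower_bidiagonal A"

definition nonnegative_mat :: "real mat \<Rightarrow> bool" where
  "nonnegative_mat A \<longleftrightarrow> (\<forall>i<dim_row A. \<forall>j<dim_col A. 0 \<le> A $$ (i, j))"

text \<open>The index sets \<open>I\<close>, \<open>J\<close> are kept inside the index ranges (rows and columns are counted
  from 0), so that \<open>submatrix A I J\<close> is square of size \<open>card I\<close>; the empty minor equals 1.\<close>

definition totally_nonnegative :: "real mat \<Rightarrow> bool" where
  "totally_nonnegative A \<longleftrightarrow>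
     (\<forall>I J. I \<subseteq> {..<dim_row A} \<longrightarrow> J \<subseteq> {..<dim_col A} \<longrightarrow> card I = card J \<longrightarrow>
        0 \<le> det (submatrix A I J))"

text \<open>The matrix type carries no topology, so the series \<open>\<Sum>k. A\<^sup>k / k!\<close> is taken
  entry by entry. It is meant for square \<open>A\<close>; \<open>mat_exp_index_sums\<close> below shows that it
  then converges.\<close>

definition mat_exp :: "real mat \<Rightarrow> real mat" where
  "mat_exp A = mat (dim_row A) (dim_row A) (\<lambda>(i, j). \<Sum>k. (A ^\<^sub>m k) $$ (i, j) / fact k)"

lemma mat_exp_carrier [simp]: "A \<in> carrier_mat n n \<Longrightarrow> mat_exp A \<in> carrier_mat n n"
  by (auto simp: mat_exp_def)

lemma norm_bound_pow_mat:
  fixes A :: "real mat"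
  assumes A: "A \<in> carrier_mat n n" and b: "norm_bound A b"
  shows "norm_bound (A ^\<^sub>m k) ((b * real n) ^ k)"
proof (induction k)
  case 0
  show ?case using A by (auto simp: norm_bound_def)
next
  case (Suc k)
  have "norm_bound (A ^\<^sub>m k * A) ((b * real n) ^ k * b * real n)"
    by (rule norm_bound_mult[OF pow_carrier_mat[OF A] A Suc.IH b])
  then show ?case by (simp add: mult_ac)
qed

lemma mat_exp_index_sums:
  fixes A :: "real mat"
  assumes A: "A \<in> carrier_mat n n" and ij: "i < n" "j < n"
  shows "(\<lambda>k. (A ^\<^sub>m k) $$ (i, j) / fact k) sums (mat_exp A $$ (i, j))"
proof -
  obtain b where b: "norm_bound A b"
    using norm_bound_max by blast
  have "norm ((A ^\<^sub>m k) $$ (i, j) / fact k) \<le> inverse (fact k) * (b * real n) ^ k" for k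
  proof -
    have "\<bar>(A ^\<^sub>m k) $$ (i, j)\<bar> \<le> (b * real n) ^ k"
      using norm_bound_pow_mat[OF A b, of k] pow_carrier_mat[OF A, of k] A ij
      by (auto simp: norm_bound_def split: if_splits)
    then show ?thesis by (simp add: field_simps)
  qed
  then have "summable (\<lambda>k. (A ^\<^sub>m k) $$ (i, j) / fact k)"
    by (intro summable_comparison_test'[OF summable_exp[of "b * real n"]])
  then show ?thesis
    using A ij by (simp add: mat_exp_def summable_sums)
qed

end

theory Submission
  imports "HOL-Analysis.Uniform_Limit" Defs
begin

text \<open>
  The exponential is the entrywise limit of \<open>(1 + B / m)\<^sup>m\<close>, and if \<open>B\<close> is nonnegative and
  bidiagonal then so is \<open>1 + B / m\<close>. Two closure properties therefore suffice. A limit of matrices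
  with nonnegative minors has nonnegative minors, because each minor is a polynomial in the entries
  (\<open>nonneg_minors_limit\<close>). And right multiplication by a nonnegative upper bidiagonal matrix
  preserves nonnegativity of all minors (\<open>nonneg_minors_mult_upper_bidiagonal\<close>), so that all powers
  of \<open>1 + B / m\<close> have nonnegative minors, starting from the identity. Lower bidiagonal matrices
  reduce to upper bidiagonal ones, since transposition commutes with the exponential and permutes
  the minors.

  The closure under products rests on multilinearity of the determinant. Column \<open>j\<close> of \<open>P U\<close> is a nonnegative combination of the columns \<open>j\<close> and \<open>j - 1\<close> of \<open>P\<close>.
  Expanding the columns of a minor of \<open>P U\<close> one at a time writes it as a nonnegative combination
  of determinants formed from columns of \<open>P\<close>. Each selected index moves left by at most one, so
  the order of the indices can degenerate only by two neighbours becoming equal, and then the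
  determinant vanishes. All other terms are minors of \<open>P\<close>.
\<close>

section \<open>Minors indexed by increasing selections\<close>

text \<open>Rows and columns of a minor are given by increasing functions on \<open>{..<k}\<close> rather than by index
  sets, because the expansion of a product moves single column indices, which is then a function
  update.\<close>

definition selection :: "nat \<Rightarrow> nat \<Rightarrow> (nat \<Rightarrow> nat) \<Rightarrow> bool" where
  "selection k n r \<longleftrightarrow> strict_mono_on {..<k} r \<and> (\<forall>i<k. r i < n)"

definition nonneg_minors :: "nat \<Rightarrow> real mat \<Rightarrow> bool" where
  "nonneg_minors n A \<longleftrightarrow>
     (\<forall>k r c. selection k n r \<longrightarrow> selection k n c \<longrightarrow>
        0 \<le> det (mat k k (\<lambda>(i, j). A $$ (r i, c j))))"

lemma nonneg_minorsD:
  "nonneg_minors n A \<Longrightarrow> selection k n r \<Longrightarrow> selection k n c \<Longrightarrow>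
    0 \<le> det (mat k k (\<lambda>(i, j). A $$ (r i, c j)))"
  unfolding nonneg_minors_def by blast

lemma selection_pick:
  assumes "I \<subseteq> {..<n}"
  shows "selection (card I) n (pick I)"
proof -
  have "pick I i < n" if "i < card I" for i
    using pick_in_set_le[OF that] assms by auto
  then show ?thesis
    unfolding selection_def strict_mono_on_def by (auto intro: pick_mono_le)
qed

lemma totally_nonnegative_if_nonneg_minors:
  assumes A: "A \<in> carrier_mat n n" and "nonneg_minors n A"
  shows "totally_nonnegative A"
  unfolding totally_nonnegative_def
proof (intro allI impI)
  fix I J assume IJ: "I \<subseteq> {..<dim_row A}" "J \<subseteq> {..<dim_col A}" "card I = card J"
  have "{i. i < dim_row A \<and> i \<in> I} = I" "{j. j < dim_col A \<and> j \<in> J} = J"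
    using IJ by auto
  then have "submatrix A I J = mat (card I) (card I) (\<lambda>(i, j). A $$ (pick I i, pick J j))"
    unfolding submatrix_def using IJ by simp
  moreover have "selection (card I) n (pick I)" "selection (card I) n (pick J)"
    using IJ A selection_pick[of I n] selection_pick[of J n] by auto
  ultimately show "0 \<le> det (submatrix A I J)"
    using nonneg_minorsD[OF assms(2)] by simp
qed

lemma nonneg_minors_transpose:
  assumes A: "A \<in> carrier_mat n n" and N: "nonneg_minors n (transpose_mat A)"
  shows "nonneg_minors n A"
  unfolding nonneg_minors_def
proof (intro allI impI)
  fix k r c assume rc: "selection k n r" "selection k n c"
  have "transpose_mat (mat k k (\<lambda>(i, j). A $$ (r i, c j)))
      = mat k k (\<lambda>(i, j). transpose_mat A $$ (c i, r j))"
    using A rc by (auto simp: selection_def)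
  then show "0 \<le> det (mat k k (\<lambda>(i, j). A $$ (r i, c j)))"
    using nonneg_minorsD[OF N rc(2,1)] det_transpose[of "mat k k (\<lambda>(i, j). A $$ (r i, c j))" k]
    by simp
qed

text \<open>A strictly increasing map on an initial segment satisfies \<open>i \<le> p i\<close>, and a permutation
  of a finite initial segment that moves no point down fixes every point.\<close>

lemma increasing_permutation_id:
  assumes p: "p permutes {0..<k::nat}" and mono: "strict_mono_on {..<k} p"
  shows "p = id"
proof (rule permutes_natset_ge[OF p])
  have "i < k \<longrightarrow> i \<le> p i" for i
  proof (induction i)
    case (Suc i)
    show ?case
    proof
      assume k: "Suc i < k"
      then have "p i < p (Suc i)"
        using mono by (auto simp: strict_mono_on_def)
      with Suc k show "Suc i \<le> p (Suc i)" by simp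
    qed
  qed simp
  then show "\<forall>i\<in>{0..<k}. i \<le> p i" by simp
qed

text \<open>A summand of the Leibniz formula for a minor of the identity is nonzero only if the permutation
  turns one increasing selection into the other. Such a permutation is increasing, hence the
  identity, which carries the sign \<open>1\<close>.\<close>

lemma nonneg_minors_one: "nonneg_minors n (1\<^sub>m n)"
  unfolding nonneg_minors_def
proof (intro allI impI)
  fix k r c assume rc: "selection k n r" "selection k n c"
  let ?M = "mat k k (\<lambda>(i, j). 1\<^sub>m n $$ (r i, c j)) :: real mat"
  have summand: "0 \<le> signof p * (\<Prod>i = 0..<k. ?M $$ (i, p i))" if p: "p permutes {0..<k}" for p
  proof (cases "\<forall>i<k. r i = c (p i)")
    case True
    have lt: "p i < k" if "i < k" for i
      using permutes_in_image[OF p, of i] that by simp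
    have "strict_mono_on {..<k} p"
    proof (rule strict_mono_onI)
      fix i j assume ij: "i \<in> {..<k}" "j \<in> {..<k}" "i < j"
      then have "r i < r j"
        using rc(1) by (auto simp: selection_def strict_mono_on_def)
      then have less: "c (p i) < c (p j)" using True ij by auto
      show "p i < p j"
      proof (rule ccontr)
        assume "\<not> p i < p j"
        then consider "p j = p i" | "p j < p i" by linarith
        then show False
        proof cases
          case 1 with less show False by simp
        next
          case 2
          then have "c (p j) < c (p i)"
            using rc(2) lt ij by (auto simp: selection_def strict_mono_on_def)
          with less show False by simp
        qed
      qed
    qed
    then have "p = id" by (rule increasing_permutation_id[OF p])
    moreover have "0 \<le> (\<Prod>i = 0..<k. ?M $$ (i, i))"
      using rc by (intro prod_nonneg) (auto simp: selection_def)
    ultimately show ?thesis by simp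
  next
    case False
    then obtain i where i: "i < k" "r i \<noteq> c (p i)" by auto
    have "p i < k" using permutes_in_image[OF p, of i] i by simp
    then have "?M $$ (i, p i) = 0" using i rc by (simp add: selection_def)
    then have "(\<Prod>i = 0..<k. ?M $$ (i, p i)) = 0"
      using i by (intro prod_zero) auto
    then show ?thesis by (simp only: mult_zero_right order_refl)
  qed
  show "0 \<le> det ?M"
    by (subst det_def'[of _ k], simp, intro sum_nonneg summand, simp)
qed

section \<open>Multiplication by a bidiagonal matrix\<close>

lemma det_linear_column:
  fixes x y :: "nat \<Rightarrow> 'a :: comm_ring_1"
  assumes s: "s < k"
  shows "det (mat k k (\<lambda>(i, j). if j = s then a * x i + b * y i else F i j))
    = a * det (mat k k (\<lambda>(i, j). if j = s then x i else F i j))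
    + b * det (mat k k (\<lambda>(i, j). if j = s then y i else F i j))"
proof -
  let ?M = "\<lambda>z. mat k k (\<lambda>(i, j). if j = s then z i else F i j)"
  have cof: "cofactor (?M z) i s = cofactor (?M x) i s" if "i < k" for z i
    unfolding cofactor_def mat_delete_def using s that
    by (intro arg_cong[where f = "\<lambda>A. _ * det A"] eq_matI) auto
  have det: "det (?M z) = (\<Sum>i<k. z i * cofactor (?M x) i s)" for z
    using laplace_expansion_column[of "?M z" k s] s cof[of _ z] by simp
  show ?thesis
    unfolding det[of x] det[of y] det[of "\<lambda>i. a * x i + b * y i"]
    by (simp add: algebra_simps sum.distrib sum_distrib_left)
qed

lemma mult_upper_bidiagonal_index:
  fixes P U :: "'a :: comm_ring_1 mat"
  assumes P: "P \<in> carrier_mat n n" and U: "U \<in> carrier_mat n n" "upper_bidiagonal U"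
    and i: "i < n" and j: "j < n"
  shows "(P * U) $$ (i, j) = U $$ (j, j) * P $$ (i, j)
    + (if j = 0 then 0 else U $$ (j - 1, j)) * P $$ (i, j - 1)"
proof -
  have zero: "U $$ (l, j) = 0" if "l < n" "l \<notin> {j - 1, j}" for l
    using U that j unfolding upper_bidiagonal_def by fastforce
  have "(P * U) $$ (i, j) = (\<Sum>l = 0..<n. P $$ (i, l) * U $$ (l, j))"
    using P U i j by (simp add: scalar_prod_def)
  also have "\<dots> = (\<Sum>l\<in>{j - 1, j}. P $$ (i, l) * U $$ (l, j))"
    using j zero by (intro sum.mono_neutral_right) auto
  also have "\<dots> = U $$ (j, j) * P $$ (i, j)
    + (if j = 0 then 0 else U $$ (j - 1, j)) * P $$ (i, j - 1)"
    by (cases j) (auto simp: mult.commute)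
  finally show ?thesis .
qed

text \<open>The columns must be expanded from left to right. When column \<open>s\<close> is reached, its left neighbour
  is already a column of \<open>P\<close>; if moving the index \<open>c s\<close> down by one makes it collide with that
  neighbour, two columns of \<open>P\<close> agree and the term vanishes. Otherwise the new indices are again
  strictly increasing, which keeps the induction going.\<close>

lemma nonneg_minors_mult_upper_bidiagonal:
  assumes P: "P \<in> carrier_mat n n" "nonneg_minors n P"
    and U: "U \<in> carrier_mat n n" "upper_bidiagonal U" "nonnegative_mat U"
  shows "nonneg_minors n (P * U)"
  unfolding nonneg_minors_def
proof (intro allI impI)
  fix k r c0 assume r: "selection k n r" and c0: "selection k n c0"
  \<comment> \<open>\<open>?D s c\<close> is the state after the first \<open>s\<close> columns have been replaced by columns of \<open>P\<close>.\<close>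
  let ?D = "\<lambda>s c. mat k k (\<lambda>(i, j). if j < s then P $$ (r i, c j) else (P * U) $$ (r i, c j))"
  have "0 \<le> det (?D s c)" if "s \<le> k" "selection k n c" for s c
    using that
  proof (induction s arbitrary: c rule: inc_induct)
    case base
    have "?D k c = mat k k (\<lambda>(i, j). P $$ (r i, c j))" by (intro eq_matI) auto
    then show ?case using nonneg_minorsD[OF P(2) r base] by simp
  next
    case (step s)
    note s = \<open>s < k\<close>
    define c' where "c' = c(s := c s - 1)"
    define a where "a = U $$ (c s, c s)"
    \<comment> \<open>Column \<open>0\<close> has no left neighbour. There \<open>c s - 1\<close> truncates to \<open>0\<close>, and the coefficient \<open>0\<close>
       removes the spurious term.\<close>
    define b where "b = (if c s = 0 then 0 else U $$ (c s - 1, c s))"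
    have cs: "c s < n" using step.prems s by (simp add: selection_def)
    have ab: "0 \<le> a" "0 \<le> b"
      using U cs by (auto simp: a_def b_def nonnegative_mat_def)
    let ?F = "\<lambda>i j. if j < s then P $$ (r i, c j) else (P * U) $$ (r i, c j)"
    have split: "?D s c = mat k k (\<lambda>(i, j). if j = s
        then a * P $$ (r i, c s) + b * P $$ (r i, c s - 1) else ?F i j)"
      using mult_upper_bidiagonal_index[OF P(1) U(1,2) _ cs] r
      by (intro eq_matI) (auto simp: a_def b_def selection_def)
    have keep: "?D (Suc s) c = mat k k (\<lambda>(i, j). if j = s then P $$ (r i, c s) else ?F i j)"
      by (intro eq_matI) auto
    have shift: "?D (Suc s) c' = mat k k (\<lambda>(i, j). if j = s then P $$ (r i, c s - 1) else ?F i j)"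
      by (intro eq_matI) (auto simp: c'_def)
    have expand: "det (?D s c) = a * det (?D (Suc s) c) + b * det (?D (Suc s) c')"
      unfolding split keep shift by (rule det_linear_column[OF s])
    have "0 \<le> b * det (?D (Suc s) c')"
    proof (cases "c s = 0 \<or> (0 < s \<and> c (s - 1) = c s - 1)")
      case True
      then consider "c s = 0" | "0 < s" "c (s - 1) = c s - 1" by linarith
      then show ?thesis
      proof cases
        case 1
        then show ?thesis by (simp add: b_def)
      next
        case 2
        have "col (?D (Suc s) c') (s - 1) = col (?D (Suc s) c') s"
          using 2 s by (intro eq_vecI) (auto simp: c'_def)
        then have "det (?D (Suc s) c') = 0"
          using 2 s by (intro det_identical_columns[of _ k "s - 1" s]) auto
        then show ?thesis by simp
      qed
    next
      case False
      have mono: "c i < c j" if "i < j" "j < k" for i j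
        using step.prems that by (auto simp: selection_def strict_mono_on_def)
      have less: "c i < c s - 1" if "i < s" for i
      proof (cases "i = s - 1")
        case True
        then show ?thesis using mono[of i s] that s False by auto
      next
        case False
        then have "c i < c (s - 1)" "c (s - 1) < c s"
          using that s mono[of i "s - 1"] mono[of "s - 1" s] by auto
        then show ?thesis by simp
      qed
      have "c' i < c' j" if "i < j" "j < k" for i j
        using that mono[OF that] less[of i] mono[of s j] by (auto simp: c'_def)
      moreover have "c' i < n" if "i < k" for i
        using step.prems cs that by (auto simp: c'_def selection_def)
      ultimately have "selection k n c'"
        unfolding selection_def strict_mono_on_def by auto
      then show ?thesis using step.IH ab by simp
    qed
    then show ?case
      unfolding expand using step.IH[OF step.prems] ab by simp
  qed
  from this[of 0 c0] show "0 \<le> det (mat k k (\<lambda>(i, j). (P * U) $$ (r i, c0 j)))"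
    using c0 by simp
qed

lemma nonneg_minors_pow_upper_bidiagonal:
  assumes "U \<in> carrier_mat n n" "upper_bidiagonal U" "nonnegative_mat U"
  shows "nonneg_minors n (U ^\<^sub>m m)"
proof (induction m)
  case 0
  show ?case using assms nonneg_minors_one by simp
next
  case (Suc m)
  then show ?case
    using nonneg_minors_mult_upper_bidiagonal[OF pow_carrier_mat[OF assms(1)] Suc assms] by simp
qed

section \<open>The exponential as a limit of powers\<close>

lemma pow_mat_one_plus_smult_index:
  fixes A :: "'a :: comm_ring_1 mat"
  assumes A: "A \<in> carrier_mat n n" and ij: "i < n" "j < n"
  shows "((1\<^sub>m n + t \<cdot>\<^sub>m A) ^\<^sub>m m) $$ (i, j)
    = (\<Sum>k\<le>m. of_nat (m choose k) * t ^ k * (A ^\<^sub>m k) $$ (i, j))"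
  using ij(2)
proof (induction m arbitrary: j)
  case 0
  show ?case using A by simp
next
  case (Suc m)
  let ?X = "1\<^sub>m n + t \<cdot>\<^sub>m A"
  let ?g = "\<lambda>k. (A ^\<^sub>m k) $$ (i, j)"
  have X: "?X \<in> carrier_mat n n" using A by simp
  note Xm = pow_carrier_mat[OF X, of m]
  have pow_Suc: "(A ^\<^sub>m Suc k) $$ (i, j) = (\<Sum>l = 0..<n. (A ^\<^sub>m k) $$ (i, l) * A $$ (l, j))" for k
    using A ij Suc.prems by (simp add: scalar_prod_def)
  have "?X ^\<^sub>m Suc m = ?X ^\<^sub>m m * 1\<^sub>m n + ?X ^\<^sub>m m * (t \<cdot>\<^sub>m A)"
    unfolding pow_mat.simps by (rule mult_add_distrib_mat[OF Xm]) (use A in auto)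
  also have "\<dots> = ?X ^\<^sub>m m + t \<cdot>\<^sub>m (?X ^\<^sub>m m * A)"
    using right_mult_one_mat[OF Xm] mult_smult_distrib[OF Xm A] by simp
  finally have "(?X ^\<^sub>m Suc m) $$ (i, j)
      = (?X ^\<^sub>m m) $$ (i, j) + t * (\<Sum>l = 0..<n. (?X ^\<^sub>m m) $$ (i, l) * A $$ (l, j))"
    using Xm A ij Suc.prems by (simp add: scalar_prod_def)
  also have "(\<Sum>l = 0..<n. (?X ^\<^sub>m m) $$ (i, l) * A $$ (l, j))
      = (\<Sum>l = 0..<n. \<Sum>k\<le>m. of_nat (m choose k) * t ^ k * ((A ^\<^sub>m k) $$ (i, l) * A $$ (l, j)))"
    by (intro sum.cong refl) (simp add: Suc.IH sum_distrib_right mult.assoc)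
  also have "\<dots> = (\<Sum>k\<le>m. of_nat (m choose k) * t ^ k * ?g (Suc k))"
    unfolding pow_Suc by (subst sum.swap) (simp add: sum_distrib_left)
  also have "(?X ^\<^sub>m m) $$ (i, j) = (\<Sum>k\<le>Suc m. of_nat (m choose k) * t ^ k * ?g k)"
    using Suc.IH[OF Suc.prems] by (simp add: binomial_eq_0)
  also have "\<dots> = ?g 0 + (\<Sum>k\<le>m. of_nat (m choose Suc k) * t ^ Suc k * ?g (Suc k))"
    by (subst sum.atMost_Suc_shift) simp
  also have "\<dots> + t * (\<Sum>k\<le>m. of_nat (m choose k) * t ^ k * ?g (Suc k))
      = ?g 0 + (\<Sum>k\<le>m. of_nat (Suc m choose Suc k) * t ^ Suc k * ?g (Suc k))"
    by (simp add: sum_distrib_left sum.distrib algebra_simps del: pow_mat.simps)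
  also have "\<dots> = (\<Sum>k\<le>Suc m. of_nat (Suc m choose k) * t ^ k * ?g k)"
    by (subst sum.atMost_Suc_shift) simp
  finally show ?case .
qed

text \<open>The coefficient of \<open>A\<^sup>k\<close> in \<open>(1 + A / m)\<^sup>m\<close> tends to that of the exponential series from below.
  The two lemmas that follow provide the pointwise limits and the domination in Tannery's theorem.\<close>

lemma choose_over_power_tendsto:
  "(\<lambda>m. real (m choose k) * (1 / real m) ^ k) \<longlonglongrightarrow> 1 / fact k"
proof -
  have "(\<lambda>m. (\<Prod>i<k. 1 - real i / real m) / fact k) \<longlonglongrightarrow> (\<Prod>i<k. 1 - 0) / fact k"
    by (intro tendsto_intros lim_const_over_n) simp
  then have "(\<lambda>m. (\<Prod>i<k. 1 - real i / real m) / fact k) \<longlonglongrightarrow> 1 / fact k"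
    by simp
  moreover have "\<forall>\<^sub>F m in sequentially.
      (\<Prod>i<k. 1 - real i / real m) / fact k = real (m choose k) * (1 / real m) ^ k"
  proof (rule eventually_sequentiallyI[of 1])
    fix m :: nat assume m: "1 \<le> m"
    have "(\<Prod>i<k. 1 - real i / real m) = (\<Prod>i<k. (real m - real i) * (1 / real m))"
      using m by (intro prod.cong) (auto simp: field_simps)
    also have "\<dots> = (\<Prod>i<k. real m - real i) * (1 / real m) ^ k"
      by (subst prod.distrib) simp
    finally show "(\<Prod>i<k. 1 - real i / real m) / fact k = real (m choose k) * (1 / real m) ^ k"
      by (simp add: binomial_gbinomial gbinomial_prod_rev atLeast0LessThan)
  qed
  ultimately show ?thesis by (rule Lim_transform_eventually)
qed

lemma choose_over_power_le: "real (m choose k) * (1 / real m) ^ k \<le> 1 / fact k"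
proof (cases "m = 0")
  case True
  then show ?thesis by (cases k) auto
next
  case False
  have "real ((m choose k) * fact k) \<le> real (m ^ k)"
    using binomial_fact_pow by (simp only: of_nat_le_iff)
  then show ?thesis using False by (simp add: field_simps)
qed

lemma mat_exp_index_limit:
  assumes A: "A \<in> carrier_mat n n" and ij: "i < n" "j < n"
  shows "(\<lambda>m. ((1\<^sub>m n + (1 / real m) \<cdot>\<^sub>m A) ^\<^sub>m m) $$ (i, j)) \<longlonglongrightarrow> mat_exp A $$ (i, j)"
proof -
  obtain b where b: "norm_bound A b" using norm_bound_max by blast
  let ?g = "\<lambda>k. (A ^\<^sub>m k) $$ (i, j)"
  let ?f = "\<lambda>k m. real (m choose k) * (1 / real m) ^ k * ?g k"
  let ?h = "\<lambda>k. inverse (fact k) * (b * real n) ^ k"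
  have bound: "norm (?f k m) \<le> ?h k" for k m
  proof -
    have "\<bar>?g k\<bar> \<le> (b * real n) ^ k"
      using norm_bound_pow_mat[OF A b, of k] A ij by (auto simp: norm_bound_def)
    then have "real (m choose k) * (1 / real m) ^ k * \<bar>?g k\<bar> \<le> 1 / fact k * (b * real n) ^ k"
      by (intro mult_mono choose_over_power_le) auto
    then show ?thesis by (simp add: abs_mult inverse_eq_divide)
  qed
  have "(\<lambda>m. \<Sum>k. ?f k m) \<longlonglongrightarrow> (\<Sum>k. 1 / fact k * ?g k)"
  proof (rule tannerys_theorem[where M = ?h, THEN conjunct2, THEN conjunct2])
    show "(\<lambda>m. ?f k m) \<longlonglongrightarrow> 1 / fact k * ?g k" for k
      by (intro tendsto_mult_right choose_over_power_tendsto)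
    show "\<forall>\<^sub>F (k, m) in at_top \<times>\<^sub>F sequentially. norm (?f k m) \<le> ?h k"
      using bound by (intro always_eventually) auto
    show "summable ?h" using summable_exp[of "b * real n"] by simp
  qed auto
  moreover have "(\<Sum>k. 1 / fact k * ?g k) = mat_exp A $$ (i, j)"
    using sums_unique[OF mat_exp_index_sums[OF A ij]] by simp
  moreover have "(\<Sum>k. ?f k m) = ((1\<^sub>m n + (1 / real m) \<cdot>\<^sub>m A) ^\<^sub>m m) $$ (i, j)" for m
  proof -
    have "(\<Sum>k. ?f k m) = (\<Sum>k\<le>m. ?f k m)"
      by (rule suminf_finite) (auto simp: not_le)
    then show ?thesis using pow_mat_one_plus_smult_index[OF A ij] by simp
  qed
  ultimately show ?thesis by simp
qed

text \<open>The Leibniz formula makes a minor a polynomial in the entries, hence continuous for entrywise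
  convergence.\<close>

lemma nonneg_minors_limit:
  assumes lim: "\<And>i j. i < n \<Longrightarrow> j < n \<Longrightarrow> (\<lambda>m. X m $$ (i, j)) \<longlonglongrightarrow> L $$ (i, j)"
    and X: "\<And>m. nonneg_minors n (X m)"
  shows "nonneg_minors n L"
  unfolding nonneg_minors_def
proof (intro allI impI)
  fix k r c assume rc: "selection k n r" "selection k n c"
  have det: "det (mat k k (\<lambda>(i, j). A $$ (r i, c j)))
      = (\<Sum>p | p permutes {0..<k}. signof p * (\<Prod>i = 0..<k. A $$ (r i, c (p i))))"
    for A :: "real mat"
  proof -
    have "(\<Prod>i = 0..<k. mat k k (\<lambda>(i, j). A $$ (r i, c j)) $$ (i, p i))
        = (\<Prod>i = 0..<k. A $$ (r i, c (p i)))" if "p permutes {0..<k}" for p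
      using permutes_in_image[OF that] by (intro prod.cong) auto
    then show ?thesis by (subst det_def'[of _ k]) (auto intro!: sum.cong)
  qed
  have "(\<lambda>m. det (mat k k (\<lambda>(i, j). X m $$ (r i, c j))))
      \<longlonglongrightarrow> det (mat k k (\<lambda>(i, j). L $$ (r i, c j)))"
    unfolding det
  proof (intro tendsto_sum tendsto_mult tendsto_const tendsto_prod lim)
    fix p i assume p: "p \<in> {p. p permutes {0..<k}}" and i: "i \<in> {0..<k}"
    then have "p i < k" using permutes_in_image[of p "{0..<k}" i] by simp
    then show "r i < n" "c (p i) < n" using rc i by (auto simp: selection_def)
  qed
  then show "0 \<le> det (mat k k (\<lambda>(i, j). L $$ (r i, c j)))"
    by (rule LIMSEQ_le_const) (use nonneg_minorsD[OF X rc] in auto)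
qed

lemma nonneg_minors_mat_exp_upper_bidiagonal:
  assumes B: "B \<in> carrier_mat n n" "upper_bidiagonal B" "nonnegative_mat B"
  shows "nonneg_minors n (mat_exp B)"
proof (rule nonneg_minors_limit)
  show "(\<lambda>m. ((1\<^sub>m n + (1 / real m) \<cdot>\<^sub>m B) ^\<^sub>m m) $$ (i, j)) \<longlonglongrightarrow> mat_exp B $$ (i, j)"
    if "i < n" "j < n" for i j
    by (rule mat_exp_index_limit[OF B(1) that])
  show "nonneg_minors n ((1\<^sub>m n + (1 / real m) \<cdot>\<^sub>m B) ^\<^sub>m m)" for m
    using B by (intro nonneg_minors_pow_upper_bidiagonal)
      (auto simp: upper_bidiagonal_def nonnegative_mat_def)
qed

section \<open>Reduction of the lower bidiagonal case by transposition\<close>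

lemma transpose_pow_mat:
  fixes A :: "'a :: comm_ring_1 mat"
  assumes A: "A \<in> carrier_mat n n"
  shows "transpose_mat A ^\<^sub>m k = transpose_mat (A ^\<^sub>m k)"
proof (induction k)
  case 0
  show ?case using A by simp
next
  case (Suc k)
  have comm: "A ^\<^sub>m k * A = A * A ^\<^sub>m k"
    using A by (induction k) (auto simp: assoc_mult_mat[of _ n n _ n _ n])
  have "transpose_mat A ^\<^sub>m Suc k = transpose_mat (A ^\<^sub>m k) * transpose_mat A"
    using Suc by simp
  also have "\<dots> = transpose_mat (A * A ^\<^sub>m k)"
    by (rule transpose_mult[symmetric, OF A pow_carrier_mat[OF A]])
  finally show ?case using comm by simp
qed

lemma transpose_mat_exp:
  assumes A: "A \<in> carrier_mat n n"
  shows "transpose_mat (mat_exp A) = mat_exp (transpose_mat A)"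
proof (rule eq_matI)
  fix i j assume ij: "i < dim_row (mat_exp (transpose_mat A))" "j < dim_col (mat_exp (transpose_mat A))"
  have "(transpose_mat (A ^\<^sub>m k)) $$ (i, j) = (A ^\<^sub>m k) $$ (j, i)" for k
    using pow_carrier_mat[OF A, of k] ij A by (simp add: mat_exp_def)
  then show "transpose_mat (mat_exp A) $$ (i, j) = mat_exp (transpose_mat A) $$ (i, j)"
    using A ij by (simp add: mat_exp_def transpose_pow_mat)
qed (use A in \<open>auto simp: mat_exp_def\<close>)

theorem theorem6p2:
  fixes B :: "real mat" and n :: nat
  assumes "B \<in> carrier_mat n n"
    and "nonnegative_mat B"
    and "bidiagonal B"
  shows "totally_nonnegative (mat_exp B)"
proof -
  have exp: "mat_exp B \<in> carrier_mat n n" using assms(1) by simp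
  have "nonneg_minors n (mat_exp B)"
  proof (cases "upper_bidiagonal B")
    case True
    with assms show ?thesis by (intro nonneg_minors_mat_exp_upper_bidiagonal)
  next
    case False
    then have "upper_bidiagonal (transpose_mat B)"
      using assms(3) by (simp add: bidiagonal_def lower_bidiagonal_def)
    moreover have "nonnegative_mat (transpose_mat B)"
      using assms(2) by (simp add: nonnegative_mat_def)
    ultimately have "nonneg_minors n (mat_exp (transpose_mat B))"
      using assms(1) by (intro nonneg_minors_mat_exp_upper_bidiagonal) auto
    then show ?thesis
      using nonneg_minors_transpose[OF exp] transpose_mat_exp[OF assms(1)] by simp
  qed
  then show ?thesis by (rule totally_nonnegative_if_nonneg_minors[OF exp])
qed

end
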